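(* Let $(\mathcal C,\mathcal D)$ be a quantum Manin pair with action functor $T\colon\mathcal C\to\mathcal D$ and right adjoint $T^R\colon\mathcal D\to\mathcal C$. Then the algebra $T^R(1)\in\mathcal C$ is commutative, i.e. its multiplication $m$ satisfies $m\circ\sigma_{T^R(1),T^R(1)}=m$.
   Context: All monoidal categories are $k$-linear ($k$ a commutative ring), locally presentable, with tensor product preserving colimits in each variable. A quantum Manin pair $(\mathcal C,\mathcal D)$ is a braided monoidal category $\mathcal C$ with braiding $\sigma$ and a monoidal category $\mathcal D$ together with a colimit-preserving braided monoidal functor from $\mathcal C$ to the Drinfeld center of $\mathcal D$; explicitly, a colimit-preserving monoidal functor $T\colon\mathcal C\to\mathcal D$ (the action functor) and isomorphisms $\tau_{X,V}\colon T(X)\otimes V\to V\otimes T(X)$ natural in $X\in\mathcal C$, $V\in\mathcal D$, compatible with tensor products and units in $X$ and in $V$, and with $\tau_{X,T(Y)}=T(\sigma_{X,Y})$ under the monoidal structure of $T$. The right adjoint $T^R$ is canonically lax monoidal, so that $T^R(1)$ is an algebra in $\mathcal C$. *)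

theory Defs
  imports "HOL-Algebra.Module"
begin

section \<open>Categories, functors, adjunctions\<close>

record ('o, 'm) cat =
  Obj :: "'o set"
  Arr :: "'m set"
  Dom :: "'m \<Rightarrow> 'o"
  Cod :: "'m \<Rightarrow> 'o"
  Idt :: "'o \<Rightarrow> 'm" (\<open>id\<index>\<close>)
  Comp :: "'m \<Rightarrow> 'm \<Rightarrow> 'm" (infixr \<open>\<bullet>\<index>\<close> 55)

text \<open>Composition is written in the usual order: \<open>g \<bullet>\<^bsub>C\<^esub> f\<close> is \<open>g\<close> after \<open>f\<close>.\<close>

definition homset :: "('o, 'm, 'z) cat_scheme \<Rightarrow> 'o \<Rightarrow> 'o \<Rightarrow> 'm set" where
  "homset C x y = {f \<in> Arr C. Dom C f = x \<and> Cod C f = y}"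

locale category =
  fixes C :: "('o, 'm, 'z) cat_scheme" (structure)
  assumes dom_obj: "f \<in> Arr C \<Longrightarrow> Dom C f \<in> Obj C"
    and cod_obj: "f \<in> Arr C \<Longrightarrow> Cod C f \<in> Obj C"
    and idt_hom: "x \<in> Obj C \<Longrightarrow> id x \<in> homset C x x"
    and comp_hom: "\<lbrakk>f \<in> homset C x y; g \<in> homset C y z\<rbrakk> \<Longrightarrow> g \<bullet> f \<in> homset C x z"
    and comp_idt_left: "f \<in> homset C x y \<Longrightarrow> id y \<bullet> f = f"
    and comp_idt_right: "f \<in> homset C x y \<Longrightarrow> f \<bullet> id x = f"
    and comp_assoc: "\<lbrakk>f \<in> homset C w x; g \<in> homset C x y; h \<in> homset C y z\<rbrakk>
      \<Longrightarrow> (h \<bullet> g) \<bullet> f = h \<bullet> (g \<bullet> f)"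

definition is_inverse :: "('o, 'm, 'z) cat_scheme \<Rightarrow> 'm \<Rightarrow> 'm \<Rightarrow> bool" where
  "is_inverse C f g \<longleftrightarrow> g \<in> homset C (Cod C f) (Dom C f)
     \<and> g \<bullet>\<^bsub>C\<^esub> f = id\<^bsub>C\<^esub> (Dom C f) \<and> f \<bullet>\<^bsub>C\<^esub> g = id\<^bsub>C\<^esub> (Cod C f)"

definition isos :: "('o, 'm, 'z) cat_scheme \<Rightarrow> 'o \<Rightarrow> 'o \<Rightarrow> 'm set" where
  "isos C x y = {f \<in> homset C x y. \<exists>g. is_inverse C f g}"

definition inverse_arr :: "('o, 'm, 'z) cat_scheme \<Rightarrow> 'm \<Rightarrow> 'm" where
  "inverse_arr C f = (THE g. is_inverse C f g)"

record ('o, 'm, 'p, 'n) fctr =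
  fob :: "'o \<Rightarrow> 'p"
  far :: "'m \<Rightarrow> 'n"

definition comp_fctr :: "('p, 'n, 'q, 'l) fctr \<Rightarrow> ('o, 'm, 'p, 'n) fctr \<Rightarrow> ('o, 'm, 'q, 'l) fctr" where
  "comp_fctr G F = \<lparr>fob = \<lambda>x. fob G (fob F x), far = \<lambda>f. far G (far F f)\<rparr>"

locale cat_functor =
  dom: category C + cod: category D
  for C :: "('o, 'm, 'z) cat_scheme" and D :: "('p, 'n, 'y) cat_scheme" +
  fixes F :: "('o, 'm, 'p, 'n) fctr"
  assumes fob_obj: "x \<in> Obj C \<Longrightarrow> fob F x \<in> Obj D"
    and far_hom: "f \<in> homset C x y \<Longrightarrow> far F f \<in> homset D (fob F x) (fob F y)"
    and far_idt: "x \<in> Obj C \<Longrightarrow> far F (id\<^bsub>C\<^esub> x) = id\<^bsub>D\<^esub> (fob F x)"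
    and far_comp: "\<lbrakk>f \<in> homset C x y; g \<in> homset C y z\<rbrakk>
      \<Longrightarrow> far F (g \<bullet>\<^bsub>C\<^esub> f) = far F g \<bullet>\<^bsub>D\<^esub> far F f"

text \<open>\<open>F\<close> is left adjoint to \<open>G\<close>, with unit \<open>\<eta>\<close> and counit \<open>\<epsilon>\<close>.\<close>

locale adjunction =
  left: cat_functor C D F + right: cat_functor D C G
  for C :: "('o, 'm, 'z) cat_scheme" and D :: "('p, 'n, 'y) cat_scheme"
    and F :: "('o, 'm, 'p, 'n) fctr" and G :: "('p, 'n, 'o, 'm) fctr" +
  fixes \<eta> :: "'o \<Rightarrow> 'm" and \<epsilon> :: "'p \<Rightarrow> 'n"
  assumes unit_hom: "x \<in> Obj C \<Longrightarrow> \<eta> x \<in> homset C x (fob G (fob F x))"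
    and unit_natural: "f \<in> homset C x y \<Longrightarrow> far G (far F f) \<bullet>\<^bsub>C\<^esub> \<eta> x = \<eta> y \<bullet>\<^bsub>C\<^esub> f"
    and counit_hom: "v \<in> Obj D \<Longrightarrow> \<epsilon> v \<in> homset D (fob F (fob G v)) v"
    and counit_natural: "g \<in> homset D v w \<Longrightarrow> g \<bullet>\<^bsub>D\<^esub> \<epsilon> v = \<epsilon> w \<bullet>\<^bsub>D\<^esub> far F (far G g)"
    and triangle_left: "x \<in> Obj C \<Longrightarrow> \<epsilon> (fob F x) \<bullet>\<^bsub>D\<^esub> far F (\<eta> x) = id\<^bsub>D\<^esub> (fob F x)"
    and triangle_right: "v \<in> Obj D \<Longrightarrow> far G (\<epsilon> v) \<bullet>\<^bsub>C\<^esub> \<eta> (fob G v) = id\<^bsub>C\<^esub> (fob G v)"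


section \<open>Colimits and local presentability\<close>

text \<open>
  Size is measured by an uncountable regular cardinal \<open>\<kappa>\<close>, given as a cardinal order on a
  subset of a type \<open>'u\<close>; a set is small if its cardinality is below \<open>\<kappa>\<close>.  When \<open>\<kappa>\<close> is the
  cardinality of a Grothendieck universe (that is, also a strong limit) these are the usual
  notions relative to that universe.  Since \<open>'u\<close> has room for \<open>\<kappa>\<close> many elements, every small
  category is isomorphic to one whose objects and arrows are elements of \<open>'u\<close>, so it suffices
  to let index categories range over the type \<open>('u, 'u) cat\<close>.
\<close>

definition regular_cardinal :: "'u rel \<Rightarrow> bool" where
  "regular_cardinal r \<longleftrightarrow> Card_order r \<and> infinite (Field r) \<and> regularCard r"

definition size_cardinal :: "'u rel \<Rightarrow> bool" where
  "size_cardinal \<kappa> \<longleftrightarrow> regular_cardinal \<kappa> \<and> (natLeq, \<kappa>) \<in> ordLess"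

definition small :: "'u rel \<Rightarrow> 'a set \<Rightarrow> bool" where
  "small \<kappa> A \<longleftrightarrow> (card_of A, \<kappa>) \<in> ordLess"

definition small_category :: "'u rel \<Rightarrow> ('i, 'j, 'z) cat_scheme \<Rightarrow> bool" where
  "small_category \<kappa> J \<longleftrightarrow> category J \<and> small \<kappa> (Obj J) \<and> small \<kappa> (Arr J)"

definition locally_small :: "'u rel \<Rightarrow> ('o, 'm, 'z) cat_scheme \<Rightarrow> bool" where
  "locally_small \<kappa> C \<longleftrightarrow> (\<forall>x\<in>Obj C. \<forall>y\<in>Obj C. small \<kappa> (homset C x y))"

definition is_cocone :: "('i, 'j, 'w) cat_scheme \<Rightarrow> ('o, 'm, 'z) cat_scheme
    \<Rightarrow> ('i, 'j, 'o, 'm) fctr \<Rightarrow> 'o \<Rightarrow> ('i \<Rightarrow> 'm) \<Rightarrow> bool" where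
  "is_cocone J C F c \<psi> \<longleftrightarrow> c \<in> Obj C
     \<and> (\<forall>j\<in>Obj J. \<psi> j \<in> homset C (fob F j) c)
     \<and> (\<forall>u\<in>Arr J. \<psi> (Cod J u) \<bullet>\<^bsub>C\<^esub> far F u = \<psi> (Dom J u))"

definition is_colimit :: "('i, 'j, 'w) cat_scheme \<Rightarrow> ('o, 'm, 'z) cat_scheme
    \<Rightarrow> ('i, 'j, 'o, 'm) fctr \<Rightarrow> 'o \<Rightarrow> ('i \<Rightarrow> 'm) \<Rightarrow> bool" where
  "is_colimit J C F c \<psi> \<longleftrightarrow> is_cocone J C F c \<psi>
     \<and> (\<forall>d \<phi>. is_cocone J C F d \<phi> \<longrightarrow>
          (\<exists>!h. h \<in> homset C c d \<and> (\<forall>j\<in>Obj J. h \<bullet>\<^bsub>C\<^esub> \<psi> j = \<phi> j)))"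

definition preserves_colimits_over :: "('i, 'j, 'w) cat_scheme \<Rightarrow> ('o, 'm, 'z) cat_scheme
    \<Rightarrow> ('p, 'n, 'y) cat_scheme \<Rightarrow> ('o, 'm, 'p, 'n) fctr \<Rightarrow> bool" where
  "preserves_colimits_over J C D G \<longleftrightarrow>
     (\<forall>F c \<psi>. cat_functor J C F \<and> is_colimit J C F c \<psi> \<longrightarrow>
        is_colimit J D (comp_fctr G F) (fob G c) (\<lambda>j. far G (\<psi> j)))"

definition cocomplete :: "'u rel \<Rightarrow> ('o, 'm, 'z) cat_scheme \<Rightarrow> bool" where
  "cocomplete \<kappa> C \<longleftrightarrow>
     (\<forall>(J :: ('u, 'u) cat) F. small_category \<kappa> J \<and> cat_functor J C F \<longrightarrow>
        (\<exists>c \<psi>. is_colimit J C F c \<psi>))"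

definition preserves_colimits :: "'u rel \<Rightarrow> ('o, 'm, 'z) cat_scheme
    \<Rightarrow> ('p, 'n, 'y) cat_scheme \<Rightarrow> ('o, 'm, 'p, 'n) fctr \<Rightarrow> bool" where
  "preserves_colimits \<kappa> C D G \<longleftrightarrow>
     (\<forall>J :: ('u, 'u) cat. small_category \<kappa> J \<longrightarrow> preserves_colimits_over J C D G)"

text \<open>In a \<open>\<mu>\<close>-filtered category every diagram with fewer than \<open>\<mu>\<close> arrows has a cocone;
  the empty diagram makes it nonempty.\<close>

definition filtered :: "'u rel \<Rightarrow> ('i, 'j, 'z) cat_scheme \<Rightarrow> bool" where
  "filtered \<mu> J \<longleftrightarrow>
     (\<forall>(K :: ('u, 'u) cat) F. small_category \<mu> K \<and> cat_functor K J F \<longrightarrow>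
        (\<exists>c \<psi>. is_cocone K J F c \<psi>))"

text \<open>The category of small sets with elements in \<open>'a\<close>.  An arrow is a triple of domain,
  extensional function and codomain.\<close>

definition set_cat :: "'u rel \<Rightarrow> ('a set, 'a set \<times> ('a \<Rightarrow> 'a) \<times> 'a set) cat" where
  "set_cat \<kappa> = \<lparr>Obj = {A. small \<kappa> A},
     Arr = {(A, f, B). small \<kappa> A \<and> small \<kappa> B \<and> f \<in> A \<rightarrow>\<^sub>E B},
     Dom = (\<lambda>(A, f, B). A),
     Cod = (\<lambda>(A, f, B). B),
     Idt = (\<lambda>A. (A, \<lambda>a\<in>A. a, A)),
     Comp = (\<lambda>(_, g, B') (A, f, _). (A, compose A g f, B'))\<rparr>"

definition hom_functor :: "('o, 'm, 'z) cat_scheme \<Rightarrow> 'o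
    \<Rightarrow> ('o, 'm, 'm set, 'm set \<times> ('m \<Rightarrow> 'm) \<times> 'm set) fctr" where
  "hom_functor C x = \<lparr>fob = homset C x,
     far = (\<lambda>f. (homset C x (Dom C f), \<lambda>g\<in>homset C x (Dom C f). f \<bullet>\<^bsub>C\<^esub> g,
                 homset C x (Cod C f)))\<rparr>"

definition presentable :: "'u rel \<Rightarrow> 'u rel \<Rightarrow> ('o, 'm, 'z) cat_scheme \<Rightarrow> 'o \<Rightarrow> bool" where
  "presentable \<kappa> \<mu> C x \<longleftrightarrow> x \<in> Obj C \<and>
     (\<forall>J :: ('u, 'u) cat. small_category \<kappa> J \<and> filtered \<mu> J \<longrightarrow>
        preserves_colimits_over J C (set_cat \<kappa>) (hom_functor C x))"

definition locally_presentable :: "'u rel \<Rightarrow> ('o, 'm, 'z) cat_scheme \<Rightarrow> bool" where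
  "locally_presentable \<kappa> C \<longleftrightarrow> category C \<and> locally_small \<kappa> C \<and> cocomplete \<kappa> C \<and>
     (\<exists>(\<mu> :: 'u rel) S. regular_cardinal \<mu> \<and> (\<mu>, \<kappa>) \<in> ordLess
        \<and> small \<kappa> S \<and> (\<forall>s\<in>S. presentable \<kappa> \<mu> C s)
        \<and> (\<forall>x\<in>Obj C. \<exists>(J :: ('u, 'u) cat) F \<psi>. small_category \<kappa> J \<and> filtered \<mu> J
              \<and> cat_functor J C F \<and> (\<forall>j\<in>Obj J. fob F j \<in> S) \<and> is_colimit J C F x \<psi>))"


section \<open>Monoidal and braided monoidal categories\<close>

record ('o, 'm) moncat = "('o, 'm) cat" +
  Tensor_ob :: "'o \<Rightarrow> 'o \<Rightarrow> 'o" (infixr \<open>\<otimes>\<^sub>o\<index>\<close> 70)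
  Tensor_ar :: "'m \<Rightarrow> 'm \<Rightarrow> 'm" (infixr \<open>\<otimes>\<^sub>a\<index>\<close> 70)
  Unit_ob :: 'o (\<open>\<I>\<index>\<close>)
  Assoc :: "'o \<Rightarrow> 'o \<Rightarrow> 'o \<Rightarrow> 'm" (\<open>\<alpha>\<index>\<close>)
  Lunit :: "'o \<Rightarrow> 'm" (\<open>\<ll>\<index>\<close>)
  Runit :: "'o \<Rightarrow> 'm" (\<open>\<rr>\<index>\<close>)

locale monoidal_category = category C
  for C :: "('o, 'm, 'z) moncat_scheme" (structure) +
  assumes tensor_obj: "\<lbrakk>x \<in> Obj C; y \<in> Obj C\<rbrakk> \<Longrightarrow> x \<otimes>\<^sub>o y \<in> Obj C"
    and tensor_hom: "\<lbrakk>f \<in> homset C x x'; g \<in> homset C y y'\<rbrakk>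
      \<Longrightarrow> f \<otimes>\<^sub>a g \<in> homset C (x \<otimes>\<^sub>o y) (x' \<otimes>\<^sub>o y')"
    and tensor_idt: "\<lbrakk>x \<in> Obj C; y \<in> Obj C\<rbrakk> \<Longrightarrow> id x \<otimes>\<^sub>a id y = id (x \<otimes>\<^sub>o y)"
    and tensor_comp: "\<lbrakk>f \<in> homset C x x'; f' \<in> homset C x' x''; g \<in> homset C y y'; g' \<in> homset C y' y''\<rbrakk>
      \<Longrightarrow> (f' \<bullet> f) \<otimes>\<^sub>a (g' \<bullet> g) = (f' \<otimes>\<^sub>a g') \<bullet> (f \<otimes>\<^sub>a g)"
    and unit_obj: "\<I> \<in> Obj C"
    and assoc_iso: "\<lbrakk>x \<in> Obj C; y \<in> Obj C; z \<in> Obj C\<rbrakk>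
      \<Longrightarrow> \<alpha> x y z \<in> isos C ((x \<otimes>\<^sub>o y) \<otimes>\<^sub>o z) (x \<otimes>\<^sub>o (y \<otimes>\<^sub>o z))"
    and assoc_natural: "\<lbrakk>f \<in> homset C x x'; g \<in> homset C y y'; h \<in> homset C z z'\<rbrakk>
      \<Longrightarrow> \<alpha> x' y' z' \<bullet> ((f \<otimes>\<^sub>a g) \<otimes>\<^sub>a h) = (f \<otimes>\<^sub>a (g \<otimes>\<^sub>a h)) \<bullet> \<alpha> x y z"
    and lunit_iso: "x \<in> Obj C \<Longrightarrow> \<ll> x \<in> isos C (\<I> \<otimes>\<^sub>o x) x"
    and lunit_natural: "f \<in> homset C x y \<Longrightarrow> \<ll> y \<bullet> (id \<I> \<otimes>\<^sub>a f) = f \<bullet> \<ll> x"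
    and runit_iso: "x \<in> Obj C \<Longrightarrow> \<rr> x \<in> isos C (x \<otimes>\<^sub>o \<I>) x"
    and runit_natural: "f \<in> homset C x y \<Longrightarrow> \<rr> y \<bullet> (f \<otimes>\<^sub>a id \<I>) = f \<bullet> \<rr> x"
    and pentagon: "\<lbrakk>w \<in> Obj C; x \<in> Obj C; y \<in> Obj C; z \<in> Obj C\<rbrakk>
      \<Longrightarrow> (id w \<otimes>\<^sub>a \<alpha> x y z) \<bullet> \<alpha> w (x \<otimes>\<^sub>o y) z \<bullet> (\<alpha> w x y \<otimes>\<^sub>a id z)
        = \<alpha> w x (y \<otimes>\<^sub>o z) \<bullet> \<alpha> (w \<otimes>\<^sub>o x) y z"
    and triangle: "\<lbrakk>x \<in> Obj C; y \<in> Obj C\<rbrakk>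
      \<Longrightarrow> (id x \<otimes>\<^sub>a \<ll> y) \<bullet> \<alpha> x \<I> y = \<rr> x \<otimes>\<^sub>a id y"

locale braided_monoidal_category = monoidal_category C
  for C :: "('o, 'm, 'z) moncat_scheme" (structure) +
  fixes \<sigma> :: "'o \<Rightarrow> 'o \<Rightarrow> 'm"
  assumes braiding_iso: "\<lbrakk>x \<in> Obj C; y \<in> Obj C\<rbrakk> \<Longrightarrow> \<sigma> x y \<in> isos C (x \<otimes>\<^sub>o y) (y \<otimes>\<^sub>o x)"
    and braiding_natural: "\<lbrakk>f \<in> homset C x x'; g \<in> homset C y y'\<rbrakk>
      \<Longrightarrow> \<sigma> x' y' \<bullet> (f \<otimes>\<^sub>a g) = (g \<otimes>\<^sub>a f) \<bullet> \<sigma> x y"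
    and hexagon_left: "\<lbrakk>x \<in> Obj C; y \<in> Obj C; z \<in> Obj C\<rbrakk>
      \<Longrightarrow> \<alpha> y z x \<bullet> \<sigma> x (y \<otimes>\<^sub>o z) \<bullet> \<alpha> x y z
        = (id y \<otimes>\<^sub>a \<sigma> x z) \<bullet> \<alpha> y x z \<bullet> (\<sigma> x y \<otimes>\<^sub>a id z)"
    and hexagon_right: "\<lbrakk>x \<in> Obj C; y \<in> Obj C; z \<in> Obj C\<rbrakk>
      \<Longrightarrow> inverse_arr C (\<alpha> z x y) \<bullet> \<sigma> (x \<otimes>\<^sub>o y) z \<bullet> inverse_arr C (\<alpha> x y z)
        = (\<sigma> x z \<otimes>\<^sub>a id y) \<bullet> inverse_arr C (\<alpha> x z y) \<bullet> (id x \<otimes>\<^sub>a \<sigma> y z)"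

text \<open>Strong monoidal functors: \<open>\<mu> x y : F x \<otimes> F y \<rightarrow> F (x \<otimes> y)\<close> and \<open>\<iota> : 1 \<rightarrow> F 1\<close>
  are invertible.\<close>

locale monoidal_functor =
  cat_functor C D F + dom: monoidal_category C + cod: monoidal_category D
  for C :: "('o, 'm, 'z) moncat_scheme" and D :: "('p, 'n, 'y) moncat_scheme"
    and F :: "('o, 'm, 'p, 'n) fctr" +
  fixes \<mu> :: "'o \<Rightarrow> 'o \<Rightarrow> 'n" and \<iota> :: 'n
  assumes mult_iso: "\<lbrakk>x \<in> Obj C; y \<in> Obj C\<rbrakk>
      \<Longrightarrow> \<mu> x y \<in> isos D (fob F x \<otimes>\<^sub>o\<^bsub>D\<^esub> fob F y) (fob F (x \<otimes>\<^sub>o\<^bsub>C\<^esub> y))"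
    and mult_natural: "\<lbrakk>f \<in> homset C x x'; g \<in> homset C y y'\<rbrakk>
      \<Longrightarrow> \<mu> x' y' \<bullet>\<^bsub>D\<^esub> (far F f \<otimes>\<^sub>a\<^bsub>D\<^esub> far F g) = far F (f \<otimes>\<^sub>a\<^bsub>C\<^esub> g) \<bullet>\<^bsub>D\<^esub> \<mu> x y"
    and unit_iso: "\<iota> \<in> isos D \<I>\<^bsub>D\<^esub> (fob F \<I>\<^bsub>C\<^esub>)"
    and mult_assoc: "\<lbrakk>x \<in> Obj C; y \<in> Obj C; z \<in> Obj C\<rbrakk>
      \<Longrightarrow> far F (\<alpha>\<^bsub>C\<^esub> x y z) \<bullet>\<^bsub>D\<^esub> \<mu> (x \<otimes>\<^sub>o\<^bsub>C\<^esub> y) z \<bullet>\<^bsub>D\<^esub> (\<mu> x y \<otimes>\<^sub>a\<^bsub>D\<^esub> id\<^bsub>D\<^esub> (fob F z))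
        = \<mu> x (y \<otimes>\<^sub>o\<^bsub>C\<^esub> z) \<bullet>\<^bsub>D\<^esub> (id\<^bsub>D\<^esub> (fob F x) \<otimes>\<^sub>a\<^bsub>D\<^esub> \<mu> y z) \<bullet>\<^bsub>D\<^esub> \<alpha>\<^bsub>D\<^esub> (fob F x) (fob F y) (fob F z)"
    and mult_lunit: "x \<in> Obj C
      \<Longrightarrow> far F (\<ll>\<^bsub>C\<^esub> x) \<bullet>\<^bsub>D\<^esub> \<mu> \<I>\<^bsub>C\<^esub> x \<bullet>\<^bsub>D\<^esub> (\<iota> \<otimes>\<^sub>a\<^bsub>D\<^esub> id\<^bsub>D\<^esub> (fob F x)) = \<ll>\<^bsub>D\<^esub> (fob F x)"
    and mult_runit: "x \<in> Obj C
      \<Longrightarrow> far F (\<rr>\<^bsub>C\<^esub> x) \<bullet>\<^bsub>D\<^esub> \<mu> x \<I>\<^bsub>C\<^esub> \<bullet>\<^bsub>D\<^esub> (id\<^bsub>D\<^esub> (fob F x) \<otimes>\<^sub>a\<^bsub>D\<^esub> \<iota>) = \<rr>\<^bsub>D\<^esub> (fob F x)"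


section \<open>Linear and locally presentable monoidal categories\<close>

record ('o, 'm, 'k) lin_moncat = "('o, 'm) moncat" +
  Hom :: "'o \<Rightarrow> 'o \<Rightarrow> ('k, 'm) module"

text \<open>Composition and tensor product of morphisms are bilinear over the commutative ring \<open>R\<close>.
  The ring-multiplication fields that the type of \<open>Hom C x y\<close> inherits from rings are unused.\<close>

locale linear_monoidal_category = monoidal_category C + cring R
  for R :: "('k, 'r) ring_scheme" and C :: "('o, 'm, 'k, 'z) lin_moncat_scheme" +
  assumes Hom_module: "\<lbrakk>x \<in> Obj C; y \<in> Obj C\<rbrakk> \<Longrightarrow> module R (Hom C x y)"
    and Hom_carrier: "\<lbrakk>x \<in> Obj C; y \<in> Obj C\<rbrakk> \<Longrightarrow> carrier (Hom C x y) = homset C x y"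
    and comp_add_left: "\<lbrakk>f \<in> homset C x y; g \<in> homset C y z; g' \<in> homset C y z\<rbrakk>
      \<Longrightarrow> (g \<oplus>\<^bsub>Hom C y z\<^esub> g') \<bullet>\<^bsub>C\<^esub> f = (g \<bullet>\<^bsub>C\<^esub> f) \<oplus>\<^bsub>Hom C x z\<^esub> (g' \<bullet>\<^bsub>C\<^esub> f)"
    and comp_add_right: "\<lbrakk>f \<in> homset C x y; f' \<in> homset C x y; g \<in> homset C y z\<rbrakk>
      \<Longrightarrow> g \<bullet>\<^bsub>C\<^esub> (f \<oplus>\<^bsub>Hom C x y\<^esub> f') = (g \<bullet>\<^bsub>C\<^esub> f) \<oplus>\<^bsub>Hom C x z\<^esub> (g \<bullet>\<^bsub>C\<^esub> f')"
    and comp_smult_left: "\<lbrakk>a \<in> carrier R; f \<in> homset C x y; g \<in> homset C y z\<rbrakk>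
      \<Longrightarrow> (a \<odot>\<^bsub>Hom C y z\<^esub> g) \<bullet>\<^bsub>C\<^esub> f = a \<odot>\<^bsub>Hom C x z\<^esub> (g \<bullet>\<^bsub>C\<^esub> f)"
    and comp_smult_right: "\<lbrakk>a \<in> carrier R; f \<in> homset C x y; g \<in> homset C y z\<rbrakk>
      \<Longrightarrow> g \<bullet>\<^bsub>C\<^esub> (a \<odot>\<^bsub>Hom C x y\<^esub> f) = a \<odot>\<^bsub>Hom C x z\<^esub> (g \<bullet>\<^bsub>C\<^esub> f)"
    and tensor_add_left: "\<lbrakk>f \<in> homset C x x'; f' \<in> homset C x x'; g \<in> homset C y y'\<rbrakk>
      \<Longrightarrow> (f \<oplus>\<^bsub>Hom C x x'\<^esub> f') \<otimes>\<^sub>a\<^bsub>C\<^esub> g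
        = (f \<otimes>\<^sub>a\<^bsub>C\<^esub> g) \<oplus>\<^bsub>Hom C (x \<otimes>\<^sub>o\<^bsub>C\<^esub> y) (x' \<otimes>\<^sub>o\<^bsub>C\<^esub> y')\<^esub> (f' \<otimes>\<^sub>a\<^bsub>C\<^esub> g)"
    and tensor_add_right: "\<lbrakk>f \<in> homset C x x'; g \<in> homset C y y'; g' \<in> homset C y y'\<rbrakk>
      \<Longrightarrow> f \<otimes>\<^sub>a\<^bsub>C\<^esub> (g \<oplus>\<^bsub>Hom C y y'\<^esub> g')
        = (f \<otimes>\<^sub>a\<^bsub>C\<^esub> g) \<oplus>\<^bsub>Hom C (x \<otimes>\<^sub>o\<^bsub>C\<^esub> y) (x' \<otimes>\<^sub>o\<^bsub>C\<^esub> y')\<^esub> (f \<otimes>\<^sub>a\<^bsub>C\<^esub> g')"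
    and tensor_smult_left: "\<lbrakk>a \<in> carrier R; f \<in> homset C x x'; g \<in> homset C y y'\<rbrakk>
      \<Longrightarrow> (a \<odot>\<^bsub>Hom C x x'\<^esub> f) \<otimes>\<^sub>a\<^bsub>C\<^esub> g
        = a \<odot>\<^bsub>Hom C (x \<otimes>\<^sub>o\<^bsub>C\<^esub> y) (x' \<otimes>\<^sub>o\<^bsub>C\<^esub> y')\<^esub> (f \<otimes>\<^sub>a\<^bsub>C\<^esub> g)"
    and tensor_smult_right: "\<lbrakk>a \<in> carrier R; f \<in> homset C x x'; g \<in> homset C y y'\<rbrakk>
      \<Longrightarrow> f \<otimes>\<^sub>a\<^bsub>C\<^esub> (a \<odot>\<^bsub>Hom C y y'\<^esub> g)
        = a \<odot>\<^bsub>Hom C (x \<otimes>\<^sub>o\<^bsub>C\<^esub> y) (x' \<otimes>\<^sub>o\<^bsub>C\<^esub> y')\<^esub> (f \<otimes>\<^sub>a\<^bsub>C\<^esub> g)"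

definition tensor_left :: "('o, 'm, 'z) moncat_scheme \<Rightarrow> 'o \<Rightarrow> ('o, 'm, 'o, 'm) fctr" where
  "tensor_left C x = \<lparr>fob = \<lambda>y. x \<otimes>\<^sub>o\<^bsub>C\<^esub> y, far = \<lambda>f. id\<^bsub>C\<^esub> x \<otimes>\<^sub>a\<^bsub>C\<^esub> f\<rparr>"

definition tensor_right :: "('o, 'm, 'z) moncat_scheme \<Rightarrow> 'o \<Rightarrow> ('o, 'm, 'o, 'm) fctr" where
  "tensor_right C x = \<lparr>fob = \<lambda>y. y \<otimes>\<^sub>o\<^bsub>C\<^esub> x, far = \<lambda>f. f \<otimes>\<^sub>a\<^bsub>C\<^esub> id\<^bsub>C\<^esub> x\<rparr>"

locale presentable_monoidal_category = linear_monoidal_category R C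
  for \<kappa> :: "'u rel" and R :: "('k, 'r) ring_scheme" and C :: "('o, 'm, 'k, 'z) lin_moncat_scheme" +
  assumes size_cardinal: "size_cardinal \<kappa>"
    and locally_presentable: "locally_presentable \<kappa> C"
    and tensor_left_colimits: "x \<in> Obj C \<Longrightarrow> preserves_colimits \<kappa> C C (tensor_left C x)"
    and tensor_right_colimits: "x \<in> Obj C \<Longrightarrow> preserves_colimits \<kappa> C C (tensor_right C x)"


section \<open>Quantum Manin pairs\<close>

text \<open>The functor to the Drinfeld center is given by the underlying monoidal functor \<open>T\<close>, with
  structure maps \<open>\<mu>\<close> and \<open>\<iota>\<close>, and the half-braidings \<open>\<tau> x v : T x \<otimes> v \<rightarrow> v \<otimes> T x\<close>.\<close>

locale quantum_manin_pair =
  C: presentable_monoidal_category \<kappa> R C + C: braided_monoidal_category C \<sigma> +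
  D: presentable_monoidal_category \<kappa> R D +
  T: monoidal_functor C D T \<mu> \<iota>
  for \<kappa> :: "'u rel" and R :: "('k, 'r) ring_scheme"
    and C :: "('o, 'm, 'k, 'z) lin_moncat_scheme" and \<sigma> :: "'o \<Rightarrow> 'o \<Rightarrow> 'm"
    and D :: "('p, 'n, 'k, 'y) lin_moncat_scheme"
    and T :: "('o, 'm, 'p, 'n) fctr" and \<mu> :: "'o \<Rightarrow> 'o \<Rightarrow> 'n" and \<iota> :: 'n +
  fixes \<tau> :: "'o \<Rightarrow> 'p \<Rightarrow> 'n"
  assumes T_colimits: "preserves_colimits \<kappa> C D T"
    and half_braiding_iso: "\<lbrakk>x \<in> Obj C; v \<in> Obj D\<rbrakk>
      \<Longrightarrow> \<tau> x v \<in> isos D (fob T x \<otimes>\<^sub>o\<^bsub>D\<^esub> v) (v \<otimes>\<^sub>o\<^bsub>D\<^esub> fob T x)"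
    and half_braiding_natural: "\<lbrakk>f \<in> homset C x y; g \<in> homset D v w\<rbrakk>
      \<Longrightarrow> \<tau> y w \<bullet>\<^bsub>D\<^esub> (far T f \<otimes>\<^sub>a\<^bsub>D\<^esub> g) = (g \<otimes>\<^sub>a\<^bsub>D\<^esub> far T f) \<bullet>\<^bsub>D\<^esub> \<tau> x v"
    and half_braiding_tensor: "\<lbrakk>x \<in> Obj C; v \<in> Obj D; w \<in> Obj D\<rbrakk>
      \<Longrightarrow> \<alpha>\<^bsub>D\<^esub> v w (fob T x) \<bullet>\<^bsub>D\<^esub> \<tau> x (v \<otimes>\<^sub>o\<^bsub>D\<^esub> w) \<bullet>\<^bsub>D\<^esub> \<alpha>\<^bsub>D\<^esub> (fob T x) v w
        = (id\<^bsub>D\<^esub> v \<otimes>\<^sub>a\<^bsub>D\<^esub> \<tau> x w) \<bullet>\<^bsub>D\<^esub> \<alpha>\<^bsub>D\<^esub> v (fob T x) w \<bullet>\<^bsub>D\<^esub> (\<tau> x v \<otimes>\<^sub>a\<^bsub>D\<^esub> id\<^bsub>D\<^esub> w)"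
    and half_braiding_unit: "x \<in> Obj C
      \<Longrightarrow> \<ll>\<^bsub>D\<^esub> (fob T x) \<bullet>\<^bsub>D\<^esub> \<tau> x \<I>\<^bsub>D\<^esub> = \<rr>\<^bsub>D\<^esub> (fob T x)"
    and action_tensor: "\<lbrakk>x \<in> Obj C; y \<in> Obj C; v \<in> Obj D\<rbrakk>
      \<Longrightarrow> \<tau> (x \<otimes>\<^sub>o\<^bsub>C\<^esub> y) v \<bullet>\<^bsub>D\<^esub> (\<mu> x y \<otimes>\<^sub>a\<^bsub>D\<^esub> id\<^bsub>D\<^esub> v)
        = (id\<^bsub>D\<^esub> v \<otimes>\<^sub>a\<^bsub>D\<^esub> \<mu> x y) \<bullet>\<^bsub>D\<^esub> \<alpha>\<^bsub>D\<^esub> v (fob T x) (fob T y)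
          \<bullet>\<^bsub>D\<^esub> (\<tau> x v \<otimes>\<^sub>a\<^bsub>D\<^esub> id\<^bsub>D\<^esub> (fob T y)) \<bullet>\<^bsub>D\<^esub> inverse_arr D (\<alpha>\<^bsub>D\<^esub> (fob T x) v (fob T y))
          \<bullet>\<^bsub>D\<^esub> (id\<^bsub>D\<^esub> (fob T x) \<otimes>\<^sub>a\<^bsub>D\<^esub> \<tau> y v) \<bullet>\<^bsub>D\<^esub> \<alpha>\<^bsub>D\<^esub> (fob T x) (fob T y) v"
    and action_unit: "v \<in> Obj D
      \<Longrightarrow> \<tau> \<I>\<^bsub>C\<^esub> v \<bullet>\<^bsub>D\<^esub> (\<iota> \<otimes>\<^sub>a\<^bsub>D\<^esub> id\<^bsub>D\<^esub> v)
        = (id\<^bsub>D\<^esub> v \<otimes>\<^sub>a\<^bsub>D\<^esub> \<iota>) \<bullet>\<^bsub>D\<^esub> inverse_arr D (\<rr>\<^bsub>D\<^esub> v) \<bullet>\<^bsub>D\<^esub> \<ll>\<^bsub>D\<^esub> v"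
    and action_braided: "\<lbrakk>x \<in> Obj C; y \<in> Obj C\<rbrakk>
      \<Longrightarrow> \<mu> y x \<bullet>\<^bsub>D\<^esub> \<tau> x (fob T y) = far T (\<sigma> x y) \<bullet>\<^bsub>D\<^esub> \<mu> x y"

text \<open>The lax structure map \<open>G v \<otimes> G w \<rightarrow> G (v \<otimes> w)\<close> of the right adjoint \<open>G\<close> of \<open>F\<close>, the adjunct
  of \<open>F (G v \<otimes> G w) \<cong> F (G v) \<otimes> F (G w) \<rightarrow> v \<otimes> w\<close>.\<close>

definition right_adjoint_lax :: "('o, 'm, 'z) moncat_scheme \<Rightarrow> ('p, 'n, 'y) moncat_scheme
    \<Rightarrow> ('o \<Rightarrow> 'o \<Rightarrow> 'n) \<Rightarrow> ('p, 'n, 'o, 'm) fctr \<Rightarrow> ('o \<Rightarrow> 'm) \<Rightarrow> ('p \<Rightarrow> 'n) \<Rightarrow> 'p \<Rightarrow> 'p \<Rightarrow> 'm" where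
  "right_adjoint_lax C D \<mu> G \<eta> \<epsilon> v w =
     far G ((\<epsilon> v \<otimes>\<^sub>a\<^bsub>D\<^esub> \<epsilon> w) \<bullet>\<^bsub>D\<^esub> inverse_arr D (\<mu> (fob G v) (fob G w)))
       \<bullet>\<^bsub>C\<^esub> \<eta> (fob G v \<otimes>\<^sub>o\<^bsub>C\<^esub> fob G w)"

text \<open>The multiplication \<open>G 1 \<otimes> G 1 \<rightarrow> G (1 \<otimes> 1) \<rightarrow> G 1\<close> of the algebra \<open>G 1\<close>.\<close>

definition right_adjoint_unit_mult :: "('o, 'm, 'z) moncat_scheme \<Rightarrow> ('p, 'n, 'y) moncat_scheme
    \<Rightarrow> ('o \<Rightarrow> 'o \<Rightarrow> 'n) \<Rightarrow> ('p, 'n, 'o, 'm) fctr \<Rightarrow> ('o \<Rightarrow> 'm) \<Rightarrow> ('p \<Rightarrow> 'n) \<Rightarrow> 'm" where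
  "right_adjoint_unit_mult C D \<mu> G \<eta> \<epsilon> =
     far G (\<ll>\<^bsub>D\<^esub> \<I>\<^bsub>D\<^esub>) \<bullet>\<^bsub>C\<^esub> right_adjoint_lax C D \<mu> G \<eta> \<epsilon> \<I>\<^bsub>D\<^esub> \<I>\<^bsub>D\<^esub>"

end

theory Submission
  imports Defs
begin

text \<open>
  The multiplication of \<open>A = T\<^sup>R 1\<close> is the adjunct of
  \<open>T (A \<otimes> A) \<cong> T A \<otimes> T A \<rightarrow> 1 \<otimes> 1 \<cong> 1\<close>, built from two copies of the counit \<open>T A \<rightarrow> 1\<close>.
  Precomposing with \<open>\<sigma>\<close> amounts to precomposing \<open>T A \<otimes> T A \<rightarrow> 1 \<otimes> 1\<close> with the half-braiding
  \<open>\<tau> A (T A)\<close>.  By naturality in the second variable the half-braiding can be moved past the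
  counit, where it becomes \<open>\<tau> A 1\<close>; this is the canonical map because half-braidings are
  compatible with the unit.  What remains is the coincidence of the two unitors at \<open>1\<close>.
\<close>

section \<open>Inverses and cancellation of isomorphisms\<close>

context category
begin

lemma isos_hom: "f \<in> isos C x y \<Longrightarrow> f \<in> homset C x y"
  by (simp add: isos_def)

text \<open>Makes the definite description in \<open>inverse_arr\<close> well defined: a left
  inverse and a right inverse of the same arrow agree.\<close>

lemma inverse_unique:
  assumes f: "f \<in> Arr C" and "is_inverse C f g" and "is_inverse C f h"
  shows "g = h"
proof -
  let ?x = "Dom C f" and ?y = "Cod C f"
  have f: "f \<in> homset C ?x ?y" using f by (simp add: homset_def)
  have g: "g \<in> homset C ?y ?x" "g \<bullet> f = id ?x" and h: "h \<in> homset C ?y ?x" "f \<bullet> h = id ?y"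
    using assms by (auto simp: is_inverse_def)
  have "g = g \<bullet> (f \<bullet> h)" using g h comp_idt_right by simp
  also have "\<dots> = (g \<bullet> f) \<bullet> h" using comp_assoc f g h by metis
  also have "\<dots> = h" using g h comp_idt_left by simp
  finally show ?thesis .
qed

lemma inverse_arr:
  assumes "f \<in> isos C x y"
  shows "inverse_arr C f \<in> homset C y x"
    and "inverse_arr C f \<bullet> f = id x"
    and "f \<bullet> inverse_arr C f = id y"
proof -
  obtain g where g: "is_inverse C f g" and f: "f \<in> Arr C" "Dom C f = x" "Cod C f = y"
    using assms by (auto simp: isos_def homset_def)
  have "inverse_arr C f = g"
    unfolding inverse_arr_def using g f inverse_unique by blast
  then show "inverse_arr C f \<in> homset C y x" "inverse_arr C f \<bullet> f = id x"
    "f \<bullet> inverse_arr C f = id y"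
    using g f by (auto simp: is_inverse_def)
qed

lemma isosI:
  assumes "f \<in> homset C x y" "g \<in> homset C y x" "g \<bullet> f = id x" "f \<bullet> g = id y"
  shows "f \<in> isos C x y"
  using assms by (auto simp: isos_def is_inverse_def homset_def)

lemma iso_cancel_right:
  assumes e: "e \<in> isos C x y" and f: "f \<in> homset C y z" and g: "g \<in> homset C y z"
    and eq: "f \<bullet> e = g \<bullet> e"
  shows "f = g"
proof -
  have "f = (f \<bullet> e) \<bullet> inverse_arr C e"
    using comp_assoc[OF inverse_arr(1)[OF e] isos_hom[OF e] f] inverse_arr(3)[OF e]
      comp_idt_right[OF f] by simp
  also have "\<dots> = g"
    unfolding eq using comp_assoc[OF inverse_arr(1)[OF e] isos_hom[OF e] g] inverse_arr(3)[OF e]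
      comp_idt_right[OF g] by simp
  finally show ?thesis .
qed

lemma iso_cancel_left:
  assumes e: "e \<in> isos C y z" and f: "f \<in> homset C x y" and g: "g \<in> homset C x y"
    and eq: "e \<bullet> f = e \<bullet> g"
  shows "f = g"
proof -
  have "f = inverse_arr C e \<bullet> (e \<bullet> f)"
    using comp_assoc[OF f isos_hom[OF e] inverse_arr(1)[OF e]] inverse_arr(2)[OF e]
      comp_idt_left[OF f] by simp
  also have "\<dots> = g"
    unfolding eq using comp_assoc[OF g isos_hom[OF e] inverse_arr(1)[OF e]] inverse_arr(2)[OF e]
      comp_idt_left[OF g] by simp
  finally show ?thesis .
qed

end

section \<open>Coherence of the unitors\<close>

context monoidal_category
begin

lemma assoc_hom:
  "\<lbrakk>x \<in> Obj C; y \<in> Obj C; z \<in> Obj C\<rbrakk> \<Longrightarrow> \<alpha> x y z \<in> homset C ((x \<otimes>\<^sub>o y) \<otimes>\<^sub>o z) (x \<otimes>\<^sub>o y \<otimes>\<^sub>o z)"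
  by (rule isos_hom[OF assoc_iso])

lemma lunit_hom: "x \<in> Obj C \<Longrightarrow> \<ll> x \<in> homset C (\<I> \<otimes>\<^sub>o x) x"
  by (rule isos_hom[OF lunit_iso])

lemma runit_hom: "x \<in> Obj C \<Longrightarrow> \<rr> x \<in> homset C (x \<otimes>\<^sub>o \<I>) x"
  by (rule isos_hom[OF runit_iso])

text \<open>Lets the edge \<open>\<alpha> \<I> \<I> x \<otimes>\<^sub>a id y\<close> of the pentagon
  be cancelled in Kelly's argument.\<close>

lemma tensor_idt_iso:
  assumes e: "e \<in> isos C x y" and z: "z \<in> Obj C" and x: "x \<in> Obj C" and y: "y \<in> Obj C"
  shows "e \<otimes>\<^sub>a id z \<in> isos C (x \<otimes>\<^sub>o z) (y \<otimes>\<^sub>o z)"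
proof (rule isosI[where g = "inverse_arr C e \<otimes>\<^sub>a id z"])
  note e' = isos_hom[OF e] and i = inverse_arr[OF e] and z' = idt_hom[OF z]
  show "e \<otimes>\<^sub>a id z \<in> homset C (x \<otimes>\<^sub>o z) (y \<otimes>\<^sub>o z)"
    "inverse_arr C e \<otimes>\<^sub>a id z \<in> homset C (y \<otimes>\<^sub>o z) (x \<otimes>\<^sub>o z)"
    using tensor_hom e' i z' by auto
  show "(inverse_arr C e \<otimes>\<^sub>a id z) \<bullet> (e \<otimes>\<^sub>a id z) = id (x \<otimes>\<^sub>o z)"
    using tensor_comp[OF e' i(1) z' z'] i(2) comp_idt_left[OF z'] tensor_idt x z by simp
  show "(e \<otimes>\<^sub>a id z) \<bullet> (inverse_arr C e \<otimes>\<^sub>a id z) = id (y \<otimes>\<^sub>o z)"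
    using tensor_comp[OF i(1) e' z' z'] i(3) comp_idt_left[OF z'] tensor_idt y z by simp
qed

text \<open>By naturality of \<open>\<ll>\<close>, the tensored arrow determines
  \<open>f \<bullet> \<ll> x\<close>, and \<open>\<ll> x\<close> is invertible.\<close>

lemma unit_tensor_faithful:
  assumes f: "f \<in> homset C x y" and g: "g \<in> homset C x y" and x: "x \<in> Obj C"
    and eq: "id \<I> \<otimes>\<^sub>a f = id \<I> \<otimes>\<^sub>a g"
  shows "f = g"
  by (rule iso_cancel_right[OF lunit_iso[OF x] f g])
    (metis lunit_natural[OF f] lunit_natural[OF g] eq)

lemma tensor_unit_faithful:
  assumes f: "f \<in> homset C x y" and g: "g \<in> homset C x y" and x: "x \<in> Obj C"
    and eq: "f \<otimes>\<^sub>a id \<I> = g \<otimes>\<^sub>a id \<I>"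
  shows "f = g"
  by (rule iso_cancel_right[OF runit_iso[OF x] f g])
    (metis runit_natural[OF f] runit_natural[OF g] eq)

lemma tensor_split:
  assumes f: "f \<in> homset C x x'" and g: "g \<in> homset C y y'"
    and "x' \<in> Obj C" and "y \<in> Obj C"
  shows "(id x' \<otimes>\<^sub>a g) \<bullet> (f \<otimes>\<^sub>a id y) = f \<otimes>\<^sub>a g"
  using tensor_comp[OF f idt_hom idt_hom g] comp_idt_left[OF f] comp_idt_right[OF g] assms
  by simp

lemma tensor_split':
  assumes f: "f \<in> homset C x x'" and g: "g \<in> homset C y y'"
    and "x \<in> Obj C" and "y' \<in> Obj C"
  shows "(f \<otimes>\<^sub>a id y') \<bullet> (id x \<otimes>\<^sub>a g) = f \<otimes>\<^sub>a g"
  using tensor_comp[OF idt_hom f g idt_hom] comp_idt_right[OF f] comp_idt_left[OF g] assms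
  by simp

text \<open>Kelly's argument: after tensoring with \<open>\<I>\<close> on the left, the claim is the pentagon at
  \<open>\<I>, \<I>, x, y\<close> with the triangle applied to two of its edges.\<close>

lemma lunit_tensor:
  assumes x: "x \<in> Obj C" and y: "y \<in> Obj C"
  shows "\<ll> (x \<otimes>\<^sub>o y) \<bullet> \<alpha> \<I> x y = \<ll> x \<otimes>\<^sub>a id y"
proof -
  note I = unit_obj
  note obj = x y I tensor_obj
  \<comment> \<open>\<open>?w\<close> marks the extra unit tensored on the left, as opposed to the
    unit in the claim. \<open>?p\<close> and \<open>?q\<close> are the pentagon edges to be
    cancelled at the end.\<close>
  let ?w = "\<I>"
  let ?p = "\<alpha> ?w (\<I> \<otimes>\<^sub>o x) y" and ?q = "\<alpha> ?w \<I> x \<otimes>\<^sub>a id y"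
  let ?l = "\<ll> (x \<otimes>\<^sub>o y)"
  have p: "?p \<in> isos C ((?w \<otimes>\<^sub>o \<I> \<otimes>\<^sub>o x) \<otimes>\<^sub>o y) (?w \<otimes>\<^sub>o (\<I> \<otimes>\<^sub>o x) \<otimes>\<^sub>o y)"
    by (intro assoc_iso obj)
  have q: "?q \<in> isos C (((?w \<otimes>\<^sub>o \<I>) \<otimes>\<^sub>o x) \<otimes>\<^sub>o y) ((?w \<otimes>\<^sub>o \<I> \<otimes>\<^sub>o x) \<otimes>\<^sub>o y)"
    by (intro tensor_idt_iso assoc_iso obj)
  note p' = isos_hom[OF p] and q' = isos_hom[OF q]
  have a: "\<alpha> \<I> x y \<in> homset C ((\<I> \<otimes>\<^sub>o x) \<otimes>\<^sub>o y) (\<I> \<otimes>\<^sub>o x \<otimes>\<^sub>o y)"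
    by (intro assoc_hom obj)
  have l: "?l \<in> homset C (\<I> \<otimes>\<^sub>o x \<otimes>\<^sub>o y) (x \<otimes>\<^sub>o y)"
    by (intro lunit_hom obj)
  have lx: "\<ll> x \<otimes>\<^sub>a id y \<in> homset C ((\<I> \<otimes>\<^sub>o x) \<otimes>\<^sub>o y) (x \<otimes>\<^sub>o y)"
    by (intro tensor_hom lunit_hom idt_hom obj)
  have idw: "id ?w \<in> homset C ?w ?w" by (intro idt_hom obj)
  have idx: "id x \<in> homset C x x" and idy: "id y \<in> homset C y y" by (intro idt_hom obj)+
  have wa: "id ?w \<otimes>\<^sub>a \<alpha> \<I> x y \<in> homset C (?w \<otimes>\<^sub>o (\<I> \<otimes>\<^sub>o x) \<otimes>\<^sub>o y) (?w \<otimes>\<^sub>o \<I> \<otimes>\<^sub>o x \<otimes>\<^sub>o y)"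
    by (rule tensor_hom[OF idw a])
  have wl: "id ?w \<otimes>\<^sub>a ?l \<in> homset C (?w \<otimes>\<^sub>o \<I> \<otimes>\<^sub>o x \<otimes>\<^sub>o y) (?w \<otimes>\<^sub>o x \<otimes>\<^sub>o y)"
    by (rule tensor_hom[OF idw l])
  have wlx: "id ?w \<otimes>\<^sub>a (\<ll> x \<otimes>\<^sub>a id y) \<in> homset C (?w \<otimes>\<^sub>o (\<I> \<otimes>\<^sub>o x) \<otimes>\<^sub>o y) (?w \<otimes>\<^sub>o x \<otimes>\<^sub>o y)"
    by (rule tensor_hom[OF idw lx])
  have b: "\<alpha> ?w \<I> (x \<otimes>\<^sub>o y) \<in> homset C ((?w \<otimes>\<^sub>o \<I>) \<otimes>\<^sub>o x \<otimes>\<^sub>o y) (?w \<otimes>\<^sub>o \<I> \<otimes>\<^sub>o x \<otimes>\<^sub>o y)"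
    by (intro assoc_hom obj)
  have c: "\<alpha> (?w \<otimes>\<^sub>o \<I>) x y \<in> homset C (((?w \<otimes>\<^sub>o \<I>) \<otimes>\<^sub>o x) \<otimes>\<^sub>o y) ((?w \<otimes>\<^sub>o \<I>) \<otimes>\<^sub>o x \<otimes>\<^sub>o y)"
    by (intro assoc_hom obj)
  have d: "\<alpha> ?w x y \<in> homset C ((?w \<otimes>\<^sub>o x) \<otimes>\<^sub>o y) (?w \<otimes>\<^sub>o x \<otimes>\<^sub>o y)"
    by (intro assoc_hom obj)
  have wlx': "id ?w \<otimes>\<^sub>a \<ll> x \<in> homset C (?w \<otimes>\<^sub>o \<I> \<otimes>\<^sub>o x) (?w \<otimes>\<^sub>o x)"
    by (intro tensor_hom lunit_hom idt_hom obj)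
  have e: "(id ?w \<otimes>\<^sub>a \<ll> x) \<otimes>\<^sub>a id y \<in> homset C ((?w \<otimes>\<^sub>o \<I> \<otimes>\<^sub>o x) \<otimes>\<^sub>o y) ((?w \<otimes>\<^sub>o x) \<otimes>\<^sub>o y)"
    by (intro tensor_hom lunit_hom idt_hom obj)
  have wx1: "\<alpha> ?w \<I> x \<in> homset C ((?w \<otimes>\<^sub>o \<I>) \<otimes>\<^sub>o x) (?w \<otimes>\<^sub>o \<I> \<otimes>\<^sub>o x)"
    by (intro assoc_hom obj)
  note rw = runit_hom[OF I]
  have "((id ?w \<otimes>\<^sub>a (?l \<bullet> \<alpha> \<I> x y)) \<bullet> ?p) \<bullet> ?q = (id ?w \<otimes>\<^sub>a ?l) \<bullet> ((id ?w \<otimes>\<^sub>a \<alpha> \<I> x y) \<bullet> ?p \<bullet> ?q)"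
  proof -
    have "id ?w \<otimes>\<^sub>a (?l \<bullet> \<alpha> \<I> x y) = (id ?w \<otimes>\<^sub>a ?l) \<bullet> (id ?w \<otimes>\<^sub>a \<alpha> \<I> x y)"
      using tensor_comp[OF idw idw a l] comp_idt_left[OF idw] by simp
    then show ?thesis
      using comp_assoc[OF q' p' comp_hom[OF wa wl]] comp_assoc[OF comp_hom[OF q' p'] wa wl]
      by simp
  qed
  also have "\<dots> = (id ?w \<otimes>\<^sub>a ?l) \<bullet> \<alpha> ?w \<I> (x \<otimes>\<^sub>o y) \<bullet> \<alpha> (?w \<otimes>\<^sub>o \<I>) x y"
    using pentagon[OF I I x y] by simp
  \<comment> \<open>First triangle, at \<open>?w\<close> and
    \<open>x \<otimes>\<^sub>o y\<close>.\<close>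
  also have "\<dots> = (\<rr> ?w \<otimes>\<^sub>a id (x \<otimes>\<^sub>o y)) \<bullet> \<alpha> (?w \<otimes>\<^sub>o \<I>) x y"
    using comp_assoc[OF c b wl] triangle[OF I tensor_obj[OF x y]] by simp
  also have "\<dots> = \<alpha> ?w x y \<bullet> ((\<rr> ?w \<otimes>\<^sub>a id x) \<otimes>\<^sub>a id y)"
    using assoc_natural[OF rw idx idy] tensor_idt[OF x y] by simp
  \<comment> \<open>Second triangle, at \<open>?w\<close> and \<open>x\<close>, read backwards and
    tensored with \<open>id y\<close>; this brings \<open>?q\<close> back as the rightmost
    factor.\<close>
  also have "\<dots> = \<alpha> ?w x y \<bullet> ((id ?w \<otimes>\<^sub>a \<ll> x) \<otimes>\<^sub>a id y) \<bullet> ?q"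
    using triangle[OF I x] tensor_comp[OF wx1 wlx' idy idy] comp_idt_left[OF idy] by simp
  also have "\<dots> = (\<alpha> ?w x y \<bullet> ((id ?w \<otimes>\<^sub>a \<ll> x) \<otimes>\<^sub>a id y)) \<bullet> ?q"
    using comp_assoc[OF q' e d] by simp
  also have "\<dots> = ((id ?w \<otimes>\<^sub>a (\<ll> x \<otimes>\<^sub>a id y)) \<bullet> ?p) \<bullet> ?q"
    using assoc_natural[OF idw lunit_hom[OF x] idy] by simp
  \<comment> \<open>Cancelling first \<open>?q\<close> and then \<open>?p\<close> leaves the claim
    tensored with \<open>id \<I>\<close>.\<close>
  finally have "id ?w \<otimes>\<^sub>a (?l \<bullet> \<alpha> \<I> x y) = id ?w \<otimes>\<^sub>a (\<ll> x \<otimes>\<^sub>a id y)"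
    using iso_cancel_right[OF q] iso_cancel_right[OF p] comp_hom[OF p']
      tensor_hom[OF idw comp_hom[OF a l]] wlx by metis
  then show ?thesis
    by (rule unit_tensor_faithful[OF comp_hom[OF a l] lx tensor_obj[OF tensor_obj[OF I x] y]])
qed

text \<open>Naturality of \<open>\<ll>\<close> at the arrow \<open>\<ll> x\<close> itself gives the
  equation after composition with \<open>\<ll> x\<close>, which can be cancelled.\<close>

lemma lunit_unit_tensor:
  assumes x: "x \<in> Obj C"
  shows "\<ll> (\<I> \<otimes>\<^sub>o x) = id \<I> \<otimes>\<^sub>a \<ll> x"
proof (rule iso_cancel_left[OF lunit_iso[OF x]])
  note Ix = tensor_obj[OF unit_obj x]
  show "\<ll> (\<I> \<otimes>\<^sub>o x) \<in> homset C (\<I> \<otimes>\<^sub>o \<I> \<otimes>\<^sub>o x) (\<I> \<otimes>\<^sub>o x)"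
    by (rule lunit_hom[OF Ix])
  show "id \<I> \<otimes>\<^sub>a \<ll> x \<in> homset C (\<I> \<otimes>\<^sub>o \<I> \<otimes>\<^sub>o x) (\<I> \<otimes>\<^sub>o x)"
    by (rule tensor_hom[OF idt_hom[OF unit_obj] lunit_hom[OF x]])
  show "\<ll> x \<bullet> \<ll> (\<I> \<otimes>\<^sub>o x) = \<ll> x \<bullet> (id \<I> \<otimes>\<^sub>a \<ll> x)"
    by (rule lunit_natural[OF lunit_hom[OF x], symmetric])
qed

text \<open>After tensoring with \<open>id \<I>\<close> on the right, both sides equal \<open>\<ll>
  (\<I> \<otimes>\<^sub>o \<I>) \<bullet> \<alpha> \<I> \<I> \<I>\<close>: one by
  \<open>lunit_tensor\<close>, the other by the triangle, whose
  \<open>id \<I> \<otimes>\<^sub>a \<ll> \<I>\<close> is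
  \<open>\<ll> (\<I> \<otimes>\<^sub>o \<I>)\<close>.\<close>

lemma lunit_unit_eq_runit_unit: "\<ll> \<I> = \<rr> \<I>"
proof (rule tensor_unit_faithful[OF lunit_hom runit_hom])
  have "\<ll> \<I> \<otimes>\<^sub>a id \<I> = \<ll> (\<I> \<otimes>\<^sub>o \<I>) \<bullet> \<alpha> \<I> \<I> \<I>"
    by (rule lunit_tensor[OF unit_obj unit_obj, symmetric])
  also have "\<dots> = \<rr> \<I> \<otimes>\<^sub>a id \<I>"
    using triangle lunit_unit_tensor unit_obj by simp
  finally show "\<ll> \<I> \<otimes>\<^sub>a id \<I> = \<rr> \<I> \<otimes>\<^sub>a id \<I>" .
qed (intro unit_obj tensor_obj)+

end

section \<open>Half-braidings and maps to the unit\<close>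

lemma (in quantum_manin_pair) half_braiding_to_unit:
  assumes x: "x \<in> Obj C" and v: "v \<in> Obj D"
    and e: "e \<in> homset D (fob T x) \<I>\<^bsub>D\<^esub>" and f: "f \<in> homset D v \<I>\<^bsub>D\<^esub>"
  shows "\<ll>\<^bsub>D\<^esub> \<I>\<^bsub>D\<^esub> \<bullet>\<^bsub>D\<^esub> (f \<otimes>\<^sub>a\<^bsub>D\<^esub> e) \<bullet>\<^bsub>D\<^esub> \<tau> x v = \<ll>\<^bsub>D\<^esub> \<I>\<^bsub>D\<^esub> \<bullet>\<^bsub>D\<^esub> (e \<otimes>\<^sub>a\<^bsub>D\<^esub> f)"
proof -
  let ?I = "\<I>\<^bsub>D\<^esub>" and ?X = "fob T x"
  note I = D.unit_obj and X = T.fob_obj[OF x]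
  note idI = D.idt_hom[OF I] and idX = D.idt_hom[OF X] and idv = D.idt_hom[OF v]
  note l = D.lunit_hom[OF I]
  have t: "\<tau> x v \<in> homset D (?X \<otimes>\<^sub>o\<^bsub>D\<^esub> v) (v \<otimes>\<^sub>o\<^bsub>D\<^esub> ?X)"
    and tI: "\<tau> x ?I \<in> homset D (?X \<otimes>\<^sub>o\<^bsub>D\<^esub> ?I) (?I \<otimes>\<^sub>o\<^bsub>D\<^esub> ?X)"
    using D.isos_hom half_braiding_iso x v I by blast+
  note Ie = D.tensor_hom[OF idI e] and eI = D.tensor_hom[OF e idI]
    and fX = D.tensor_hom[OF f idX] and Xf = D.tensor_hom[OF idX f]
  \<comment> \<open>Interchange is used in the order that puts \<open>f\<close> next to
    \<open>\<tau>\<close>.\<close>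
  have "\<ll>\<^bsub>D\<^esub> ?I \<bullet>\<^bsub>D\<^esub> (f \<otimes>\<^sub>a\<^bsub>D\<^esub> e) \<bullet>\<^bsub>D\<^esub> \<tau> x v
      = \<ll>\<^bsub>D\<^esub> ?I \<bullet>\<^bsub>D\<^esub> (id\<^bsub>D\<^esub> ?I \<otimes>\<^sub>a\<^bsub>D\<^esub> e) \<bullet>\<^bsub>D\<^esub> (f \<otimes>\<^sub>a\<^bsub>D\<^esub> id\<^bsub>D\<^esub> ?X) \<bullet>\<^bsub>D\<^esub> \<tau> x v"
    using D.tensor_split[OF f e I X] D.comp_assoc[OF t fX Ie] by simp
  also have "\<dots> = \<ll>\<^bsub>D\<^esub> ?I \<bullet>\<^bsub>D\<^esub> (id\<^bsub>D\<^esub> ?I \<otimes>\<^sub>a\<^bsub>D\<^esub> e) \<bullet>\<^bsub>D\<^esub> \<tau> x ?I \<bullet>\<^bsub>D\<^esub> (id\<^bsub>D\<^esub> ?X \<otimes>\<^sub>a\<^bsub>D\<^esub> f)"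
    using half_braiding_natural[OF C.idt_hom[OF x] f] T.far_idt[OF x] by simp
  also have "\<dots> = (\<ll>\<^bsub>D\<^esub> ?I \<bullet>\<^bsub>D\<^esub> (id\<^bsub>D\<^esub> ?I \<otimes>\<^sub>a\<^bsub>D\<^esub> e)) \<bullet>\<^bsub>D\<^esub> \<tau> x ?I \<bullet>\<^bsub>D\<^esub> (id\<^bsub>D\<^esub> ?X \<otimes>\<^sub>a\<^bsub>D\<^esub> f)"
    using D.comp_assoc[OF D.comp_hom[OF Xf tI] Ie l] by simp
  \<comment> \<open>Naturality of the left unitor moves \<open>e\<close> to the far left, which
    exposes the composite in the unit axiom for \<open>\<tau>\<close>.\<close>
  also have "\<dots> = e \<bullet>\<^bsub>D\<^esub> (\<ll>\<^bsub>D\<^esub> ?X \<bullet>\<^bsub>D\<^esub> \<tau> x ?I) \<bullet>\<^bsub>D\<^esub> (id\<^bsub>D\<^esub> ?X \<otimes>\<^sub>a\<^bsub>D\<^esub> f)"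
    using D.lunit_natural[OF e] D.comp_assoc[OF D.comp_hom[OF Xf tI] D.lunit_hom[OF X] e]
      D.comp_assoc[OF Xf tI D.lunit_hom[OF X]] by simp
  also have "\<dots> = (e \<bullet>\<^bsub>D\<^esub> \<rr>\<^bsub>D\<^esub> ?X) \<bullet>\<^bsub>D\<^esub> (id\<^bsub>D\<^esub> ?X \<otimes>\<^sub>a\<^bsub>D\<^esub> f)"
    using half_braiding_unit[OF x] D.comp_assoc[OF Xf D.runit_hom[OF X] e] by simp
  \<comment> \<open>Naturality of the right unitor brings \<open>e\<close> back, now as the left
    tensor factor.\<close>
  also have "\<dots> = \<rr>\<^bsub>D\<^esub> ?I \<bullet>\<^bsub>D\<^esub> (e \<otimes>\<^sub>a\<^bsub>D\<^esub> id\<^bsub>D\<^esub> ?I) \<bullet>\<^bsub>D\<^esub> (id\<^bsub>D\<^esub> ?X \<otimes>\<^sub>a\<^bsub>D\<^esub> f)"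
    using D.runit_natural[OF e] D.comp_assoc[OF Xf eI D.runit_hom[OF I]] by simp
  also have "\<dots> = \<ll>\<^bsub>D\<^esub> ?I \<bullet>\<^bsub>D\<^esub> (e \<otimes>\<^sub>a\<^bsub>D\<^esub> f)"
    using D.tensor_split'[OF e f X I] D.lunit_unit_eq_runit_unit by simp
  finally show ?thesis .
qed

section \<open>The multiplication as an adjunct\<close>

theorem proposition2p11:
  fixes \<kappa> :: "'u rel" and R :: "('k, 'r) ring_scheme"
    and C :: "('o, 'm, 'k, 'z) lin_moncat_scheme" and \<sigma> :: "'o \<Rightarrow> 'o \<Rightarrow> 'm"
    and D :: "('p, 'n, 'k, 'y) lin_moncat_scheme"
    and T :: "('o, 'm, 'p, 'n) fctr" and \<mu> :: "'o \<Rightarrow> 'o \<Rightarrow> 'n" and \<iota> :: 'n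
    and \<tau> :: "'o \<Rightarrow> 'p \<Rightarrow> 'n"
    and T_R :: "('p, 'n, 'o, 'm) fctr" and \<eta> :: "'o \<Rightarrow> 'm" and \<epsilon> :: "'p \<Rightarrow> 'n"
  assumes "quantum_manin_pair \<kappa> R C \<sigma> D T \<mu> \<iota> \<tau>"
    and "adjunction C D T T_R \<eta> \<epsilon>"
  shows "right_adjoint_unit_mult C D \<mu> T_R \<eta> \<epsilon> \<bullet>\<^bsub>C\<^esub> \<sigma> (fob T_R \<I>\<^bsub>D\<^esub>) (fob T_R \<I>\<^bsub>D\<^esub>)
    = right_adjoint_unit_mult C D \<mu> T_R \<eta> \<epsilon>"
proof -
  interpret M: quantum_manin_pair \<kappa> R C \<sigma> D T \<mu> \<iota> \<tau> by (rule assms(1))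
  interpret A: adjunction C D T T_R \<eta> \<epsilon> by (rule assms(2))
  let ?I = "\<I>\<^bsub>D\<^esub>"
  let ?A = "fob T_R ?I"
  let ?s = "\<sigma> ?A ?A" and ?m = "\<mu> ?A ?A" and ?t = "\<tau> ?A (fob T ?A)"
  let ?n = "inverse_arr D ?m" and ?e = "\<epsilon> ?I \<otimes>\<^sub>a\<^bsub>D\<^esub> \<epsilon> ?I" and ?AA = "?A \<otimes>\<^sub>o\<^bsub>C\<^esub> ?A"
  \<comment> \<open>\<open>\<phi>\<close> is the map
    \<open>T (A \<otimes> A) \<rightarrow> 1\<close> whose adjunct is the multiplication. Both
    unitor and lax structure map are absorbed into it, so that the claim becomes an equation in
    \<open>D\<close>.\<close>
  define \<phi> where "\<phi> = \<ll>\<^bsub>D\<^esub> ?I \<bullet>\<^bsub>D\<^esub> ?e \<bullet>\<^bsub>D\<^esub> ?n"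
  note I = M.D.unit_obj
  note A = A.right.fob_obj[OF I]
  note AA = M.C.tensor_obj[OF A A]
  note TA = M.T.fob_obj[OF A]
  note l = M.D.lunit_hom[OF I]
  note e = M.D.tensor_hom[OF A.counit_hom[OF I] A.counit_hom[OF I]]
  note m = M.T.mult_iso[OF A A]
  note m' = M.D.isos_hom[OF m] and n = M.D.inverse_arr[OF m]
  note s = M.C.isos_hom[OF M.C.braiding_iso[OF A A]]
  note Ts = M.T.far_hom[OF s]
  note t = M.D.isos_hom[OF M.half_braiding_iso[OF A TA]]
  note en = M.D.comp_hom[OF n(1) e]
  have \<phi>: "\<phi> \<in> homset D (fob T ?AA) ?I"
    unfolding \<phi>_def by (rule M.D.comp_hom[OF en l])
  have mult: "right_adjoint_unit_mult C D \<mu> T_R \<eta> \<epsilon> = far T_R \<phi> \<bullet>\<^bsub>C\<^esub> \<eta> ?AA"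
    unfolding right_adjoint_unit_mult_def right_adjoint_lax_def \<phi>_def
    using A.right.far_comp[OF en l]
      M.C.comp_assoc[OF A.unit_hom[OF AA] A.right.far_hom[OF en] A.right.far_hom[OF l]]
    by simp
  have "\<phi> \<bullet>\<^bsub>D\<^esub> far T ?s = \<phi>"
  \<comment> \<open>Precomposing with the invertible \<open>?m\<close> removes its inverse from
    \<open>\<phi>\<close> and lets \<open>action_braided\<close> trade \<open>far T ?s\<close> for
    the half-braiding \<open>?t\<close>.\<close>
  proof (rule M.D.iso_cancel_right[OF m M.D.comp_hom[OF Ts \<phi>] \<phi>])
    have \<phi>m: "\<phi> \<bullet>\<^bsub>D\<^esub> ?m = \<ll>\<^bsub>D\<^esub> ?I \<bullet>\<^bsub>D\<^esub> ?e"
      unfolding \<phi>_def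
      using M.D.comp_assoc[OF m' en l] M.D.comp_assoc[OF m' n(1) e] n(2) M.D.comp_idt_right[OF e]
      by simp
    have "(\<phi> \<bullet>\<^bsub>D\<^esub> far T ?s) \<bullet>\<^bsub>D\<^esub> ?m = \<phi> \<bullet>\<^bsub>D\<^esub> ?m \<bullet>\<^bsub>D\<^esub> ?t"
      using M.D.comp_assoc[OF m' Ts \<phi>] M.action_braided[OF A A] by simp
    also have "\<dots> = \<ll>\<^bsub>D\<^esub> ?I \<bullet>\<^bsub>D\<^esub> ?e \<bullet>\<^bsub>D\<^esub> ?t"
      using M.D.comp_assoc[OF t m' \<phi>] \<phi>m M.D.comp_assoc[OF t e l] by simp
    also have "\<dots> = \<phi> \<bullet>\<^bsub>D\<^esub> ?m"
      using M.half_braiding_to_unit[OF A TA A.counit_hom[OF I] A.counit_hom[OF I]] \<phi>m by simp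
    finally show "(\<phi> \<bullet>\<^bsub>D\<^esub> far T ?s) \<bullet>\<^bsub>D\<^esub> ?m = \<phi> \<bullet>\<^bsub>D\<^esub> ?m" .
  qed
  \<comment> \<open>Naturality of \<open>\<eta>\<close> at \<open>?s\<close>: precomposing an
    adjunct with \<open>?s\<close> corresponds to precomposing \<open>\<phi>\<close> with
    \<open>far T ?s\<close>.\<close>
  moreover have "(far T_R \<phi> \<bullet>\<^bsub>C\<^esub> \<eta> ?AA) \<bullet>\<^bsub>C\<^esub> ?s = far T_R (\<phi> \<bullet>\<^bsub>D\<^esub> far T ?s) \<bullet>\<^bsub>C\<^esub> \<eta> ?AA"
    using M.C.comp_assoc[OF s A.unit_hom[OF AA] A.right.far_hom[OF \<phi>]] A.unit_natural[OF s]
      A.right.far_comp[OF Ts \<phi>]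
      M.C.comp_assoc[OF A.unit_hom[OF AA] A.right.far_hom[OF Ts] A.right.far_hom[OF \<phi>]]
    by simp
  ultimately show ?thesis
    unfolding mult by simp
qed

end
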